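(* Let $\ell:\mathbb{R}\to\mathbb{R}$ be a convex monotonically increasing function and $\lambda\in\mathbb{R}$. Let $F,F'$ be (cumulative distribution functions of) probability distributions over $\mathbb{R}$. Then $\alpha\mapsto\overline{SR}_\lambda[\alpha F+(1-\alpha)F']$ is a monotone function of $\alpha\in[0,1]$.
   Context: For a function $F:\mathbb{R}\to\mathbb{R}$ (in particular a CDF), $\overline{SR}_\lambda[F]=\inf\{t\in\mathbb{R}:\int_{\mathbb{R}}\ell(z-t)\,dF(z)\le\lambda\}$. If $F$ is the CDF of a random variable $Z$, this is the utility-based shortfall risk $SR_\lambda(Z)=\inf\{t:\mathbb{E}[\ell(Z-t)]\le\lambda\}$. "Monotone" means either non-decreasing on $[0,1]$ or non-increasing on $[0,1]$. *)

theory Defs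
  imports "HOL-Probability.Distribution_Functions"
begin

text \<open>
  The integral with values in the extended reals. A convex increasing loss may be unbounded in both
  directions, so expected losses can be infinite; the Bochner integral would return \<open>0\<close> in that
  case. If both parts are infinite the integral is undefined; as \<open>\<infinity> - \<infinity> = \<infinity>\<close> holds in type
  \<^typ>\<open>ereal\<close>, its value is then \<open>\<infinity>\<close>, so that an undefined expected loss is never below a finite level.
\<close>

definition ext_integral :: "'a measure \<Rightarrow> ('a \<Rightarrow> real) \<Rightarrow> ereal" where
  "ext_integral M f =
     enn2ereal (\<integral>\<^sup>+ x. ennreal (f x) \<partial>M) - enn2ereal (\<integral>\<^sup>+ x. ennreal (- f x) \<partial>M)"

lemma ext_integral_integrable:
  assumes "integrable M f"
  shows "ext_integral M f = ereal (\<integral>x. f x \<partial>M)"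
proof -
  have fin: "(\<integral>\<^sup>+ x. ennreal (f x) \<partial>M) \<noteq> \<infinity>" "(\<integral>\<^sup>+ x. ennreal (- f x) \<partial>M) \<noteq> \<infinity>"
    using assms by (auto simp: real_integrable_def)
  have e: "enn2ereal a = ereal (enn2real a)" if "a \<noteq> \<infinity>" for a
    using that by (cases a) (auto simp: enn2ereal_ennreal)
  show ?thesis
    unfolding ext_integral_def real_lebesgue_integral_def[OF assms]
    by (simp add: e[OF fin(1)] e[OF fin(2)])
qed

text \<open>
  The integral against \<open>dF\<close> is the Lebesgue--Stieltjes integral, i.e. the integral with respect to
  \<^term>\<open>interval_measure F\<close> (meaningful for non-decreasing right-continuous \<open>F\<close>). The infimum is taken in
  the extended reals, since it may be over the empty set (\<open>\<infinity>\<close>) or unbounded below (\<open>- \<infinity>\<close>).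
\<close>

definition SR_cdf :: "(real \<Rightarrow> real) \<Rightarrow> real \<Rightarrow> (real \<Rightarrow> real) \<Rightarrow> ereal" where
  "SR_cdf l lam F =
     Inf (ereal ` {t. ext_integral (interval_measure F) (\<lambda>z. l (z - t)) \<le> ereal lam})"

lemma interval_measure_cdf:
  assumes "real_distribution M"
  shows "interval_measure (cdf M) = M"
proof -
  interpret real_distribution M by fact
  have "real_distribution (interval_measure (cdf M))"
    by (intro real_distribution_interval_measure cdf_nondecreasing cdf_is_right_cont cdf_lim_at_bot)
       (use cdf_lim_at_top_prob in auto)
  then show ?thesis
    using assms
    by (rule cdf_unique)
       (intro cdf_interval_measure cdf_nondecreasing cdf_is_right_cont cdf_lim_at_bot)
qed

lemma (in prob_space) SR_cdf_random_variable:
  assumes [measurable]: "random_variable borel Z" "l \<in> borel_measurable borel"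
  shows "SR_cdf l lam (cdf (distr M borel Z)) =
    Inf (ereal ` {t. ext_integral M (\<lambda>\<omega>. l (Z \<omega> - t)) \<le> ereal lam})"
  by (simp add: SR_cdf_def interval_measure_cdf ext_integral_def nn_integral_distr)

end

theory Submission
  imports Defs "HOL-Probability.Probability_Mass_Function"
begin

text \<open>
  The extended expected loss of a mixture is a mixture of the extended expected losses, so the
  acceptance set \<open>{t. expected loss \<le> lam}\<close> of a mixture lies between the intersection and the union of
  the acceptance sets of its components. These sets are closed upwards, hence the shortfall risk
  of a mixture lies between the shortfall risks of its components, and a function on an interval
  with this betweenness property is monotone or antimonotone.
\<close>

text \<open>Encoding the mixture as a \<open>bind\<close> over a Bernoulli draw makes its total mass
  and its integrals instances of general facts about \<open>bind\<close>.\<close>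

definition mixture :: "real \<Rightarrow> 'a measure \<Rightarrow> 'a measure \<Rightarrow> 'a measure" where
  "mixture u M N = measure_pmf (bernoulli_pmf u) \<bind> (\<lambda>b. if b then M else N)"

lemma
  assumes "real_distribution M" "real_distribution N" "0 \<le> u" "u \<le> 1"
  shows real_distribution_mixture: "real_distribution (mixture u M N)"
    and nn_integral_mixture: "f \<in> borel_measurable borel \<Longrightarrow>
      (\<integral>\<^sup>+x. f x \<partial>mixture u M N) = ennreal u * (\<integral>\<^sup>+x. f x \<partial>M) + ennreal (1 - u) * (\<integral>\<^sup>+x. f x \<partial>N)"
    and cdf_mixture: "cdf (mixture u M N) = (\<lambda>x. u * cdf M x + (1 - u) * cdf N x)"
proof -
  interpret M: real_distribution M by fact
  interpret N: real_distribution N by fact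
  let ?K = "\<lambda>b. if b then M else N"
  have K: "?K \<in> measurable (measure_pmf (bernoulli_pmf u)) (subprob_algebra borel)"
    by (auto simp: space_subprob_algebra M.subprob_space_axioms N.subprob_space_axioms)
  have prob: "prob_space (mixture u M N)"
    unfolding mixture_def
    by (intro measure_pmf.prob_space_bind[OF _ K])
       (auto simp: M.prob_space_axioms N.prob_space_axioms)
  have sets: "sets (mixture u M N) = sets borel"
    unfolding mixture_def by (intro sets_bind) auto
  interpret X: real_distribution "mixture u M N"
    by (intro real_distribution.intro prob real_distribution_axioms.intro sets)
  show "real_distribution (mixture u M N)" ..
  show nn: "(\<integral>\<^sup>+x. f x \<partial>mixture u M N)
      = ennreal u * (\<integral>\<^sup>+x. f x \<partial>M) + ennreal (1 - u) * (\<integral>\<^sup>+x. f x \<partial>N)"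
    if "f \<in> borel_measurable borel" for f
    unfolding mixture_def using assms(3,4)
    by (subst nn_integral_bind[OF that K]) (simp add: mult.commute)
  show "cdf (mixture u M N) = (\<lambda>x. u * cdf M x + (1 - u) * cdf N x)"
  proof
    fix x
    \<comment> \<open>The cdf formula is the integral formula for the indicator of
      \<open>{..x}\<close>.\<close>
    have "ennreal (cdf (mixture u M N) x) = (\<integral>\<^sup>+z. indicator {..x} z \<partial>mixture u M N)"
      by (simp add: cdf_def X.emeasure_eq_measure)
    also have "\<dots> = ennreal u * ennreal (cdf M x) + ennreal (1 - u) * ennreal (cdf N x)"
      by (subst nn) (simp_all add: cdf_def M.emeasure_eq_measure N.emeasure_eq_measure)
    also have "\<dots> = ennreal (u * cdf M x + (1 - u) * cdf N x)"
      using assms(3,4) by (simp add: ennreal_mult ennreal_plus M.cdf_nonneg N.cdf_nonneg)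
    finally show "cdf (mixture u M N) x = u * cdf M x + (1 - u) * cdf N x"
      by (rule iffD1[OF ennreal_inj, rotated 2])
         (use assms(3,4) in \<open>simp_all add: M.cdf_nonneg N.cdf_nonneg X.cdf_nonneg\<close>)
  qed
qed

lemma enn2ereal_mixture:
  "0 \<le> u \<Longrightarrow> u \<le> 1 \<Longrightarrow> enn2ereal (ennreal u * p + ennreal (1 - u) * p')
    = ereal u * enn2ereal p + ereal (1 - u) * enn2ereal p'"
  by (simp add: plus_ennreal.rep_eq times_ennreal.rep_eq enn2ereal_ennreal)

text \<open>Think of \<open>p\<close> and \<open>n\<close> as the integrals of the positive and
  negative parts of a loss. Since \<infinity> - \<infinity> = \<infinity>, the bounds force
  \<open>p\<close> and \<open>p'\<close> to be finite. An infinite \<open>n\<close> or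
  \<open>n'\<close> then makes the mixed difference -\<infinity>; otherwise all values are real and
  a half-line is convex.\<close>

lemma ereal_mixture_diff_le:
  fixes p n p' n' :: ereal
  assumes "0 < u" "u < 1" "0 \<le> p" "0 \<le> n" "0 \<le> p'" "0 \<le> n'"
    and "p - n \<le> ereal c" "p' - n' \<le> ereal c"
  shows "(ereal u * p + ereal (1 - u) * p') - (ereal u * n + ereal (1 - u) * n') \<le> ereal c"
proof -
  have "(u * a + (1 - u) * a') - (u * b + (1 - u) * b') \<le> c"
    if "a - b \<le> c" "a' - b' \<le> c" for a b a' b'
    using convex_bound_le[of "a - b" c "a' - b'" u "1 - u"] assms(1,2) that
    by (simp add: right_diff_distrib)
  then show ?thesis using assms
    by (cases p; cases n; cases p'; cases n') simp_all
qed

text \<open>This is not the dual of the previous bound, because \<infinity> - \<infinity> =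
  \<infinity> breaks the symmetry. As both weights are positive, an infinite \<open>p\<close> or
  \<open>p'\<close> makes the mixed positive part infinite, and the difference is \<infinity>
  whatever is subtracted. If both are finite, the lower bounds force \<open>n\<close> and
  \<open>n'\<close> to be finite too.\<close>

lemma ereal_mixture_diff_gt:
  fixes p n p' n' :: ereal
  assumes "0 < u" "u < 1" "0 \<le> p" "0 \<le> n" "0 \<le> p'" "0 \<le> n'"
    and "ereal c < p - n" "ereal c < p' - n'"
  shows "ereal c < (ereal u * p + ereal (1 - u) * p') - (ereal u * n + ereal (1 - u) * n')"
proof -
  have "c < (u * a + (1 - u) * a') - (u * b + (1 - u) * b')"
    if "c < a - b" "c < a' - b'" for a b a' b'
    using convex_bound_lt[of "b - a" "- c" "b' - a'" u "1 - u"] assms(1,2) that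
    by (simp add: right_diff_distrib)
  then show ?thesis using assms
    by (cases p; cases n; cases p'; cases n') simp_all
qed

definition acceptance_set :: "(real \<Rightarrow> real) \<Rightarrow> real \<Rightarrow> real measure \<Rightarrow> real set" where
  "acceptance_set l lam M = {t. ext_integral M (\<lambda>z. l (z - t)) \<le> ereal lam}"

lemma SR_cdf_acceptance_set:
  "real_distribution M \<Longrightarrow> SR_cdf l lam (cdf M) = Inf (ereal ` acceptance_set l lam M)"
  by (simp add: SR_cdf_def acceptance_set_def interval_measure_cdf)

lemma ext_integral_mono:
  assumes "\<And>x. f x \<le> g x"
  shows "ext_integral M f \<le> ext_integral M g"
  unfolding ext_integral_def
  by (intro ereal_minus_mono; unfold less_eq_ennreal.rep_eq[symmetric])
     (intro nn_integral_mono ennreal_leI; use assms in simp)+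

lemma acceptance_set_upward:
  assumes "mono l" "s \<in> acceptance_set l lam M" "s \<le> t"
  shows "t \<in> acceptance_set l lam M"
proof -
  have "ext_integral M (\<lambda>z. l (z - t)) \<le> ext_integral M (\<lambda>z. l (z - s))"
    using assms by (intro ext_integral_mono) (auto intro: monoD)
  with assms(2) show ?thesis by (auto simp: acceptance_set_def)
qed

lemma acceptance_set_mixture:
  assumes "mono l" "real_distribution M" "real_distribution N" "0 < u" "u < 1"
  shows "acceptance_set l lam M \<inter> acceptance_set l lam N \<subseteq> acceptance_set l lam (mixture u M N)"
    and "acceptance_set l lam (mixture u M N) \<subseteq> acceptance_set l lam M \<union> acceptance_set l lam N"
proof -
  have [measurable]: "l \<in> borel_measurable borel"
    using assms(1) by (rule borel_measurable_mono)
  \<comment> \<open>Positive and negative parts are mixed separately and subtracted only at the end,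
    so the identity survives infinite values.\<close>
  have eq: "ext_integral (mixture u M N) (\<lambda>z. l (z - t)) =
      (ereal u * enn2ereal (\<integral>\<^sup>+z. ennreal (l (z - t)) \<partial>M)
        + ereal (1 - u) * enn2ereal (\<integral>\<^sup>+z. ennreal (l (z - t)) \<partial>N))
      - (ereal u * enn2ereal (\<integral>\<^sup>+z. ennreal (- l (z - t)) \<partial>M)
        + ereal (1 - u) * enn2ereal (\<integral>\<^sup>+z. ennreal (- l (z - t)) \<partial>N))" for t
    using assms(2-) by (simp add: ext_integral_def nn_integral_mixture enn2ereal_mixture)
  show "acceptance_set l lam M \<inter> acceptance_set l lam N \<subseteq> acceptance_set l lam (mixture u M N)"
  proof
    fix t assume "t \<in> acceptance_set l lam M \<inter> acceptance_set l lam N"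
    then show "t \<in> acceptance_set l lam (mixture u M N)"
      unfolding acceptance_set_def mem_Collect_eq eq Int_iff unfolding ext_integral_def
      by (intro ereal_mixture_diff_le assms(4,5)) simp_all
  qed
  show "acceptance_set l lam (mixture u M N) \<subseteq> acceptance_set l lam M \<union> acceptance_set l lam N"
  proof (rule subsetI, rule ccontr)
    fix t assume t: "t \<in> acceptance_set l lam (mixture u M N)"
      and "t \<notin> acceptance_set l lam M \<union> acceptance_set l lam N"
    then have "ereal lam < ext_integral (mixture u M N) (\<lambda>z. l (z - t))"
      unfolding acceptance_set_def mem_Collect_eq eq Un_iff de_Morgan_disj not_le unfolding ext_integral_def
      by (intro ereal_mixture_diff_gt assms(4,5)) simp_all
    with t show False by (simp add: acceptance_set_def)
  qed
qed

lemma SR_cdf_mixture_between: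
  assumes "mono l" "real_distribution M" "real_distribution N" "0 < u" "u < 1"
  shows "min (SR_cdf l lam (cdf M)) (SR_cdf l lam (cdf N)) \<le> SR_cdf l lam (cdf (mixture u M N))"
    and "SR_cdf l lam (cdf (mixture u M N)) \<le> max (SR_cdf l lam (cdf M)) (SR_cdf l lam (cdf N))"
proof -
  let ?A = "acceptance_set l lam M" and ?B = "acceptance_set l lam N"
    and ?C = "acceptance_set l lam (mixture u M N)"
  have SR: "SR_cdf l lam (cdf M) = Inf (ereal ` ?A)" "SR_cdf l lam (cdf N) = Inf (ereal ` ?B)"
    "SR_cdf l lam (cdf (mixture u M N)) = Inf (ereal ` ?C)"
    using assms by (auto intro!: SR_cdf_acceptance_set real_distribution_mixture)
  \<comment> \<open>Upward closed sets of reals are nested, so the intersection and the union are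
    themselves \<open>?A\<close> or \<open>?B\<close>. Only this turns the two inclusions into
    comparisons with a single infimum.\<close>
  have "?A \<subseteq> ?B \<or> ?B \<subseteq> ?A"
    using acceptance_set_upward[OF assms(1)] by (meson linear subsetI)
  then have inter: "?A \<subseteq> ?C \<or> ?B \<subseteq> ?C"
    and union: "?C \<subseteq> ?A \<or> ?C \<subseteq> ?B"
    using acceptance_set_mixture[OF assms, of lam] by blast+
  show "min (SR_cdf l lam (cdf M)) (SR_cdf l lam (cdf N)) \<le> SR_cdf l lam (cdf (mixture u M N))"
    unfolding SR min_le_iff_disj using union by (auto intro!: Inf_superset_mono image_mono)
  show "SR_cdf l lam (cdf (mixture u M N)) \<le> max (SR_cdf l lam (cdf M)) (SR_cdf l lam (cdf N))"
    unfolding SR le_max_iff_disj using inter by (auto intro!: Inf_superset_mono image_mono)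
qed

text \<open>Betweenness is used twice: on \<open>a\<close>, \<open>x\<close>, \<open>b\<close> it
  gives \<open>f x \<le> f b\<close>, so on \<open>x\<close>, \<open>y\<close>, \<open>b\<close> the
  minimum is \<open>f x\<close>. Coinciding points are treated apart, as \<open>between\<close>
  covers strict triples only.\<close>

lemma mono_on_if_between:
  fixes f :: "real \<Rightarrow> 'a::linorder"
  assumes between: "\<And>x y z. \<lbrakk>a \<le> x; x < y; y < z; z \<le> b\<rbrakk>
      \<Longrightarrow> min (f x) (f z) \<le> f y \<and> f y \<le> max (f x) (f z)"
    and "f a \<le> f b"
  shows "mono_on {a..b} f"
proof (rule mono_onI)
  fix x y assume xy: "x \<in> {a..b}" "y \<in> {a..b}" "x \<le> y"
  have "f x \<le> f b"
    using between[of a x b] xy assms(2) by (cases "x = a"; cases "x = b") auto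
  then show "f x \<le> f y"
    using between[of x y b] xy by (cases "y = x"; cases "y = b") auto
qed

lemma antimono_on_if_between:
  fixes f :: "real \<Rightarrow> 'a::linorder"
  assumes between: "\<And>x y z. \<lbrakk>a \<le> x; x < y; y < z; z \<le> b\<rbrakk>
      \<Longrightarrow> min (f x) (f z) \<le> f y \<and> f y \<le> max (f x) (f z)"
    and "f b \<le> f a"
  shows "antimono_on {a..b} f"
proof (rule monotone_onI)
  fix x y assume xy: "x \<in> {a..b}" "y \<in> {a..b}" "x \<le> y"
  have "f b \<le> f x"
    using between[of a x b] xy assms(2) by (cases "x = a"; cases "x = b") auto
  then show "f y \<le> f x"
    using between[of x y b] xy by (cases "y = x"; cases "y = b") auto
qed

theorem theorem3:
  fixes l :: "real \<Rightarrow> real" and lam :: real and M M' :: "real measure"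
  assumes "convex_on UNIV l" and "mono l"
    and "real_distribution M" and "real_distribution M'"
  shows "mono_on {0..1} (\<lambda>\<alpha>::real. SR_cdf l lam (\<lambda>x. \<alpha> * cdf M x + (1 - \<alpha>) * cdf M' x))
       \<or> antimono_on {0..1} (\<lambda>\<alpha>::real. SR_cdf l lam (\<lambda>x. \<alpha> * cdf M x + (1 - \<alpha>) * cdf M' x))"
proof -
  define F where "F \<alpha> x = \<alpha> * cdf M x + (1 - \<alpha>) * cdf M' x" for \<alpha> x
  let ?R = "\<lambda>\<alpha>. SR_cdf l lam (F \<alpha>)"
  have between: "min (?R x) (?R z) \<le> ?R y \<and> ?R y \<le> max (?R x) (?R z)"
    if xyz: "0 \<le> x" "x < y" "y < z" "z \<le> 1" for x y z
  proof -
    \<comment> \<open>The weight is the solution of \<open>u * x + (1 - u) * z = y\<close>.\<close>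
    define u where "u = (z - y) / (z - x)"
    have u: "0 < u" "u < 1" using xyz by (auto simp: u_def)
    have y: "u * x + (1 - u) * z = y"
      using xyz by (simp add: u_def divide_simps) (simp add: algebra_simps)
    have rd: "real_distribution (mixture \<alpha> M M')" and F: "F \<alpha> = cdf (mixture \<alpha> M M')"
      if "0 \<le> \<alpha>" "\<alpha> \<le> 1" for \<alpha>
      using real_distribution_mixture cdf_mixture assms(3,4) that by (auto simp: F_def)
    have x01: "0 \<le> x" "x \<le> 1" and z01: "0 \<le> z" "z \<le> 1" using xyz by auto
    \<comment> \<open>Mixing the mixtures at \<open>x\<close> and \<open>z\<close> yields the one at
      \<open>y\<close>; on the level of cdfs this is plain algebra.\<close>
    have "F y = cdf (mixture u (mixture x M M') (mixture z M M'))"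
      using u x01 z01
      by (simp add: cdf_mixture rd F[symmetric]) (simp add: F_def[abs_def] y[symmetric] algebra_simps)
    then show ?thesis
      using SR_cdf_mixture_between[OF assms(2) rd[OF x01] rd[OF z01] u, of lam]
      by (simp add: F x01 z01)
  qed
  \<comment> \<open>The order of the two endpoint values decides the direction.\<close>
  have "mono_on {0..1} ?R \<or> antimono_on {0..1} ?R"
    using mono_on_if_between[of 0 1 ?R] antimono_on_if_between[of 0 1 ?R] between
      linear[of "?R 0" "?R 1"] by blast
  then show ?thesis by (simp add: F_def[abs_def])
qed

end
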